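(* Let $X$ be a finite dimensional real Banach space with a polyhedral norm, let $f: X \to X$ be nonexpansive, and suppose $u \in X$ is a fixed point of $f$. For each nonempty proper face $F$ of the closed unit ball $B_1$, choose $x_F$ in the relative interior of $F$ and $x_F^*$ in the relative interior of the dual face $F^*$. Then $u$ is the unique fixed point of $f$ if and only if $$\langle f(u+t x_F) - u - t x_F, x_F^*\rangle < 0$$ for all $t>0$ and every nonempty proper face $F$ of $B_1$.
   Context: A map $f:X\to X$ is nonexpansive if $\|f(x)-f(y)\|\le\|x-y\|$ for all $x,y\in X$. $X^*$ is the dual space with dual norm $\|\cdot\|_*$, $\langle x,x^*\rangle$ is the value of $x^*\in X^*$ at $x\in X$, $B_1$ is the closed unit ball of $X$. A norm is polyhedral if $B_1$ has finitely many extreme points. A convex subset $F$ of a convex set $C$ is a face of $C$ if $tx+(1-t)y\in F$ with $x,y\in C$ and $0<t<1$ implies $x,y\in F$; it is a proper face if $F\neq C$. The duality map is $J(x)=\{x^*\in X^*:\|x^*\|_*=\|x\|,\ \langle x,x^*\rangle=\|x\|\,\|x^*\|_*\}$. For a proper face $F$ of $B_1$, the dual face $F^*$ is the image of the relative interior of $F$ under $J$ (it is a face of the dual unit ball). *)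

theory Defs
  imports "HOL-Analysis.Analysis"
begin

definition finite_dimensional_space :: "'a::real_vector itself \<Rightarrow> bool" where
  "finite_dimensional_space _ \<longleftrightarrow> (\<exists>B :: 'a set. finite B \<and> span B = UNIV)"

definition polyhedral_norm :: "'a::real_normed_vector itself \<Rightarrow> bool" where
  "polyhedral_norm _ \<longleftrightarrow> finite {e :: 'a. e extreme_point_of cball 0 1}"

definition nonexpansive :: "('a::real_normed_vector \<Rightarrow> 'a) \<Rightarrow> bool" where
  "nonexpansive f \<longleftrightarrow> (\<forall>x y. norm (f x - f y) \<le> norm (x - y))"

definition nonempty_proper_faces :: "'a::real_vector set \<Rightarrow> 'a set set" where
  "nonempty_proper_faces C = {F. F face_of C \<and> F \<noteq> {} \<and> F \<noteq> C}"

(* The dual space is the type of bounded linear functionals; its norm is the operator norm,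
   i.e. the dual norm. *)
definition duality_map :: "'a::real_normed_vector \<Rightarrow> ('a \<Rightarrow>\<^sub>L real) set" where
  "duality_map x = {x'. norm x' = norm x \<and> blinfun_apply x' x = norm x * norm x'}"

(* The image of a set under the set-valued map J is the union of its values on that set. *)
definition dual_face :: "'a::real_normed_vector set \<Rightarrow> ('a \<Rightarrow>\<^sub>L real) set" where
  "dual_face F = (\<Union>x\<in>rel_interior F. duality_map x)"

end

theory Submission
  imports Defs
begin

text \<open>
  Translating by \<open>u\<close>, let \<open>g\<close> be nonexpansive with \<open>g 0 = 0\<close>. For a unit vector \<open>x\<close>, let
  \<open>J x = duality_map x\<close> be the set of norming functionals of \<open>x\<close>, and call the set of all points of the unit ball on
  which every functional in \<open>J x\<close> takes the value 1 the bidual face of \<open>x\<close>. If \<open>x\<close> lies in the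
  relative interior of a proper face \<open>F\<close>, then the dual face of \<open>F\<close> is \<open>J x\<close>
  (\<open>dual_face_eq_duality_map\<close>).

  Polyhedrality enters through a single fact: near \<open>x\<close> the unit ball coincides with its tangent
  cone (\<open>polyhedral_ball_locally_tangent_cone\<close>). Consequently there is \<open>\<eta> > 0\<close> with
  \<open>norm (x - \<eta> *\<^sub>R y) \<le> 1 - \<eta>\<close> for all \<open>y\<close> in the bidual face of \<open>x\<close>
  (\<open>norm_diff_bidual_face\<close>). This inequality drives both directions.

  If \<open>t *\<^sub>R x\<close> is a nonzero fixed point of \<open>g\<close>, let \<open>F\<close> be the bidual face of \<open>x\<close>, let \<open>y\<close> be a point
  of \<open>F\<close>, and put \<open>s = \<eta> * t\<close>. Every \<open>\<phi>\<close> in \<open>J x\<close> satisfies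
  \<open>t - \<phi> (g (s *\<^sub>R y)) \<le> norm (g (t *\<^sub>R x) - g (s *\<^sub>R y)) \<le> norm (t *\<^sub>R x - s *\<^sub>R y) \<le> t - s\<close>, so \<open>\<phi>\<close> does
  not decrease from \<open>s *\<^sub>R y\<close> to its image, and the strict inequality fails for \<open>F\<close> at \<open>s\<close>.

  Conversely, suppose that the strict inequality fails for \<open>F\<close> at \<open>t\<close>, and let \<open>p\<close> be the chosen point
  of \<open>F\<close>. Since \<open>norm (g (t *\<^sub>R p)) \<le> t\<close>, the chosen functional attains its largest possible value
  \<open>t\<close> at \<open>g (t *\<^sub>R p)\<close>; since it is a relative interior point of the dual face, all functionals in
  \<open>J p\<close> attain this value there. The same chain of inequalities then shows that \<open>g\<close> maps the set
  \<open>\<eta> * t\<close> times the bidual face of \<open>p\<close> into itself. This set is compact and convex and omits 0, so it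
  contains a nonzero fixed point.
\<close>

section \<open>Fixed points of nonexpansive maps\<close>

text \<open>
  Mixing \<open>f\<close> with a small constant part yields contractions of \<open>C\<close>. Their fixed points are almost
  fixed by \<open>f\<close>, so the displacement of \<open>f\<close>, which attains its minimum on \<open>C\<close>, has minimum 0.
\<close>
lemma nonexpansive_on_compact_convex_fixed_point:
  fixes f :: "'a::real_normed_vector \<Rightarrow> 'a"
  assumes C: "compact C" "convex C" "C \<noteq> {}" and inv: "f ` C \<subseteq> C" and f: "nonexpansive f"
  shows "\<exists>y\<in>C. f y = y"
proof -
  have ne: "norm (f a - f b) \<le> norm (a - b)" for a b
    using f by (auto simp: nonexpansive_def)
  have cont: "continuous_on C (\<lambda>y. norm (f y - y))"
  proof -
    have "1-lipschitz_on C f"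
      using ne by (auto simp: lipschitz_on_def dist_norm)
    then have "continuous_on C f" by (rule lipschitz_on_continuous_on)
    then show ?thesis by (intro continuous_intros)
  qed
  obtain y where y: "y \<in> C" and min: "\<And>z. z \<in> C \<Longrightarrow> norm (f y - y) \<le> norm (f z - z)"
    using continuous_attains_inf[OF C(1,3) cont] by auto
  obtain c where c: "c \<in> C" using C(3) by auto
  obtain K where "K > 0" and K: "\<And>z. z \<in> C \<Longrightarrow> norm z \<le> K"
    using compact_imp_bounded[OF C(1)] by (auto simp: bounded_pos)
  have small: "norm (f y - y) \<le> l * (2 * K)" if l: "0 < l" "l < 1" for l
  proof -
    define g where "g z = (1 - l) *\<^sub>R f z + l *\<^sub>R c" for z
    have "g ` C \<subseteq> C"
      using inv c l C(2) by (auto simp: g_def image_subset_iff intro!: convexD)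
    moreover have "dist (g a) (g b) \<le> (1 - l) * dist a b" for a b
    proof -
      have "g a - g b = (1 - l) *\<^sub>R (f a - f b)" by (simp add: g_def algebra_simps)
      then show ?thesis using ne[of a b] l by (simp add: dist_norm mult_left_mono)
    qed
    ultimately have "\<exists>!z\<in>C. g z = z"
      using l C by (intro Banach_fix[of C "1 - l"] compact_imp_complete) auto
    then obtain z where z: "z \<in> C" "g z = z" by blast
    have "f z - z = f z - g z" using z by simp
    also have "\<dots> = l *\<^sub>R (f z - c)" by (simp add: g_def algebra_simps)
    finally have "norm (f z - z) = l * norm (f z - c)" using l by simp
    also have "\<dots> \<le> l * (2 * K)"
    proof -
      have "norm (f z) \<le> K" "norm c \<le> K" using K c z(1) inv by auto
      then show ?thesis using l norm_triangle_ineq4[of "f z" c] by (intro mult_left_mono) auto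
    qed
    finally show ?thesis using min[OF z(1)] by simp
  qed
  have "norm (f y - y) \<le> 0"
  proof (rule field_le_epsilon)
    fix e :: real assume "e > 0"
    define l where "l = min (1/2) (e / (2 * K))"
    have "0 < l" "l < 1" "l * (2 * K) \<le> e"
      using \<open>e > 0\<close> \<open>K > 0\<close> by (auto simp: l_def min_def field_simps)
    then show "norm (f y - y) \<le> 0 + e" using small[of l] by simp
  qed
  then show ?thesis using y by auto
qed

section \<open>Linear functionals on relative interiors\<close>

text \<open>
  From \<open>y\<close> through \<open>p\<close> the segment can be prolonged slightly beyond \<open>p\<close> inside \<open>S\<close>; if \<open>g y < g p\<close>,
  then \<open>g\<close> would exceed its maximum there. The lemma is applied to faces of the unit ball and, with
  evaluation at a point as functional, to faces of the dual ball.
\<close>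
lemma linear_maximum_on_rel_interior_constant:
  fixes S :: "'b::real_normed_vector set" and g :: "'b \<Rightarrow> real"
  assumes g: "linear g" and max: "\<And>y. y \<in> S \<Longrightarrow> g y \<le> g p"
    and p: "p \<in> rel_interior S" and y: "y \<in> S"
  shows "g y = g p"
proof -
  obtain e where "p \<in> S" "e > 0" and e: "cball p e \<inter> affine hull S \<subseteq> S"
    using p by (auto simp: mem_rel_interior_cball)
  define s where "s = e / (1 + norm (p - y))"
  have "1 + norm (p - y) > 0" by (simp add: add_pos_nonneg)
  then have s: "s > 0" "s * norm (p - y) \<le> e"
    using \<open>e > 0\<close> by (auto simp: s_def field_simps)
  define q where "q = p + s *\<^sub>R (p - y)"
  have "q = (1 + s) *\<^sub>R p + (- s) *\<^sub>R y" by (simp add: q_def algebra_simps)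
  then have "q \<in> affine hull S"
    using mem_affine[OF affine_affine_hull hull_inc[OF \<open>p \<in> S\<close>] hull_inc[OF y], of "1 + s" "- s"] by simp
  moreover have "q \<in> cball p e" using s by (simp add: q_def dist_norm)
  ultimately have "g q \<le> g p" using e max by blast
  moreover have "g q = g p + s * (g p - g y)"
    using g by (simp add: q_def linear_add linear_scale linear_diff)
  ultimately have "s * (g p - g y) \<le> 0" by simp
  then have "g p \<le> g y" using s(1) by (simp add: mult_le_0_iff)
  then show ?thesis using max[OF y] by simp
qed

section \<open>Euclidean coordinates of a finite-dimensional normed space\<close>

text \<open>
  The theory of polytopes lives on types of class \<open>euclidean_space\<close>, whereas the dimension of
  \<open>'a\<close> is only known through an assumption. Indexing coordinates by a finite type that depends on
  \<open>'a\<close> turns \<open>real ^ 'a basis_index\<close> into a Euclidean type of the same dimension. Types are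
  nonempty, so in dimension 0 the index type has one element too many, and that case
  has to be treated separately.
\<close>
typedef (overloaded) 'a basis_index = "{..dim (UNIV :: 'a::real_vector set) - 1}"
  by blast

instance basis_index :: (real_vector) finite
proof
  have "finite (Abs_basis_index ` {..dim (UNIV :: 'a set) - 1} :: 'a basis_index set)" by simp
  then show "finite (UNIV :: 'a basis_index set)"
    by (simp only: type_definition.Abs_image[OF type_definition_basis_index])
qed

lemma CARD_basis_index: "CARD('a::real_vector basis_index) = Suc (dim (UNIV :: 'a set) - 1)"
  by (simp only: type_definition.card[OF type_definition_basis_index] card_atMost)

text \<open>
  The map \<open>M\<close> sends a coordinate vector to the corresponding combination of basis vectors. Its inverse
  is bounded because \<open>norm (M v)\<close> has a positive minimum on the Euclidean unit sphere.
\<close>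
lemma euclidean_coordinates:
  fixes x :: "'a::real_normed_vector"
  assumes fin: "finite_dimensional_space TYPE('a)" and "x \<noteq> 0"
  obtains M :: "real ^ ('a basis_index) \<Rightarrow> 'a" and L
  where "bounded_linear M" "bounded_linear L" "\<And>y. M (L y) = y" "\<And>v. L (M v) = v"
proof -
  obtain B0 :: "'a set" where "finite B0" "span B0 = UNIV"
    using fin by (auto simp: finite_dimensional_space_def)
  obtain B :: "'a set" where B: "B \<subseteq> B0" "independent B" "B0 \<subseteq> span B"
    by (rule maximal_independent_subset)
  have finB: "finite B" using B(1) \<open>finite B0\<close> finite_subset by auto
  have spB: "span B = UNIV"
    using \<open>span B0 = UNIV\<close> B(3) by (metis span_mono span_span top.extremum_uniqueI)
  have "B \<noteq> {}" using spB \<open>x \<noteq> 0\<close> by force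
  moreover have "dim (UNIV :: 'a set) = card B"
    using B(2) spB by (metis dim_eq_card_independent dim_span)
  ultimately have "card B = CARD('a basis_index)"
    using finB by (simp add: CARD_basis_index card_gt_0_iff)
  then obtain h :: "'a basis_index \<Rightarrow> 'a" where h: "bij_betw h UNIV B"
    using finB by (metis finite finite_same_card_bij)
  define M :: "real ^ ('a basis_index) \<Rightarrow> 'a" where "M v = (\<Sum>i\<in>UNIV. v $ i *\<^sub>R h i)" for v
  have lin: "linear M"
    by (rule linearI) (simp_all add: M_def algebra_simps sum.distrib scaleR_right.sum)
  have "inj M"
  proof (subst linear_injective_0[OF lin], intro allI impI)
    fix v assume "M v = 0"
    then have "(\<Sum>b\<in>B. v $ inv_into UNIV h b *\<^sub>R b) = 0"
      using h by (simp add: M_def sum.reindex_bij_betw[OF h, symmetric] bij_betw_def)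
    then have "v $ inv_into UNIV h b = 0" if "b \<in> B" for b
      using independentD[OF B(2) finB subset_refl, of "\<lambda>b. v $ inv_into UNIV h b"] that by simp
    then have "v $ i = 0" for i
      using h by (metis bij_betw_def inv_into_f_f rangeI UNIV_I)
    then show "v = 0" by (simp add: vec_eq_iff)
  qed
  moreover have "surj M"
    unfolding surj_def
  proof
    fix y :: 'a
    have "y \<in> range (\<lambda>c. \<Sum>b\<in>B. c b *\<^sub>R b)"
      using span_finite[OF finB] spB by blast
    then obtain c where c: "y = (\<Sum>b\<in>B. c b *\<^sub>R b)" by blast
    have "y = M (\<chi> i. c (h i))"
      unfolding M_def c using sum.reindex_bij_betw[OF h, of "\<lambda>b. c b *\<^sub>R b"] by simp
    then show "\<exists>v. y = M v" ..
  qed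
  ultimately have "bij M" by (simp add: bij_def)
  define L where "L = inv M"
  have M_L: "M (L y) = y" and L_M: "L (M v) = v" for y v
    using \<open>bij M\<close> by (simp_all add: L_def bij_is_surj surj_f_inv_f bij_is_inj)
  have linL: "linear L"
  proof (rule linearI)
    show "L (a + b) = L a + L b" for a b
      using L_M[of "L a + L b"] by (simp add: linear_add[OF lin] M_L)
    show "L (c *\<^sub>R a) = c *\<^sub>R L a" for c a
      using L_M[of "c *\<^sub>R L a"] by (simp add: linear_scale[OF lin] M_L)
  qed
  have Mb: "bounded_linear M"
    using lin by (simp add: linear_conv_bounded_linear)
  have cont: "continuous_on S M" for S
    using Mb by (simp add: linear_continuous_on)
  let ?S = "sphere (0 :: real ^ ('a basis_index)) 1"
  have "?S \<noteq> {}" by simp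
  then obtain p where p: "p \<in> ?S" and pmin: "\<And>v. v \<in> ?S \<Longrightarrow> norm (M p) \<le> norm (M v)"
    using continuous_attains_inf[of ?S "\<lambda>v. norm (M v)"] continuous_on_norm[OF cont] by auto
  have "p \<noteq> 0" using p by auto
  then have pos: "norm (M p) > 0"
    using \<open>inj M\<close> lin by (metis linear_injective_0 zero_less_norm_iff)
  have below: "norm (M p) * norm v \<le> norm (M v)" for v
  proof (cases "v = 0")
    case False
    then have "norm (M p) \<le> norm (M (v /\<^sub>R norm v))" by (intro pmin) simp
    then show ?thesis using False lin by (simp add: linear_scale field_simps)
  qed (use lin linear_0 in auto)
  have "bounded_linear L"
    using linL
  proof (rule bounded_linear.intro)
    have "norm (L y) \<le> norm y * (1 / norm (M p))" for y
      using below[of "L y"] pos by (simp add: M_L field_simps)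
    then show "bounded_linear_axioms L" unfolding bounded_linear_axioms_def by blast
  qed
  then show ?thesis using that Mb M_L L_M by blast
qed

lemma compact_cball_finite_dimensional:
  fixes a :: "'a::real_normed_vector"
  assumes fin: "finite_dimensional_space TYPE('a)"
  shows "compact (cball a r)"
proof (cases "\<exists>x::'a. x \<noteq> 0")
  case False
  then have "cball a r \<subseteq> {0}" by auto
  then show ?thesis by (meson finite.emptyI finite_imp_compact finite_insert finite_subset)
next
  case True
  then obtain M :: "real ^ ('a basis_index) \<Rightarrow> 'a" and L where
    M: "bounded_linear M" and L: "bounded_linear L" and M_L: "\<And>y. M (L y) = y" and L_M: "\<And>v. L (M v) = v"
    using euclidean_coordinates[OF fin] by blast
  have contM: "continuous_on S M" for S
    using M by (simp add: linear_continuous_on)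
  have "bounded (L ` cball a r)"
    using L by (intro bounded_linear_image) auto
  moreover have "L ` cball a r = M -` cball a r"
    by (auto simp: M_L) (metis L_M imageI mem_cball)
  moreover have "closed (M -` cball a r)"
    using contM by (intro closed_vimage) auto
  ultimately have "compact (L ` cball a r)"
    by (simp add: compact_eq_bounded_closed)
  then have "compact (M ` L ` cball a r)"
    using contM by (rule compact_continuous_image[rotated])
  then show ?thesis by (simp add: image_image M_L)
qed

lemma extreme_point_of_linear_vimage:
  assumes M: "linear M" "bij M" and v: "v extreme_point_of (M -` S)"
  shows "M v extreme_point_of S"
  unfolding extreme_point_of_def
proof (intro conjI ballI notI)
  show "M v \<in> S" using v by (auto simp: extreme_point_of_def)
  fix a b assume ab: "a \<in> S" "b \<in> S" "M v \<in> open_segment a b"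
  obtain a' b' where [simp]: "a = M a'" "b = M b'"
    using M(2) by (metis bij_pointE)
  have "M v \<in> M ` open_segment a' b'"
    using ab(3) M by (simp add: open_segment_linear_image[OF M(1)] bij_is_inj)
  then have "v \<in> open_segment a' b'"
    using M(2) by (simp add: bij_is_inj inj_image_mem_iff)
  then show False using v ab(1,2) by (auto simp: extreme_point_of_def)
qed

text \<open>
  In Euclidean coordinates the unit ball is the convex hull of its finitely many extreme points
  (Krein and Milman, Minkowski), so it is an intersection of finitely many half-spaces (Minkowski and
  Weyl). Since 0 is an interior point, each half-space can be normalised to \<open>\<phi> y \<le> 1\<close>.
\<close>
lemma polyhedral_norm_finite_functionals:
  assumes fin: "finite_dimensional_space TYPE('a::real_normed_vector)"
    and poly: "polyhedral_norm TYPE('a::real_normed_vector)"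
  obtains \<Phi> :: "('a::real_normed_vector \<Rightarrow>\<^sub>L real) set" where
    "finite \<Phi>" "\<And>y::'a::real_normed_vector. norm y \<le> 1 \<longleftrightarrow> (\<forall>\<phi>\<in>\<Phi>. blinfun_apply \<phi> y \<le> 1)"
proof (cases "\<exists>x::'a. x \<noteq> 0")
  case False
  then have "norm y \<le> 1" for y :: 'a using norm_zero[where 'a = 'a] by (metis zero_le_one)
  then show ?thesis using that[of "{}"] by simp
next
  case True
  then obtain M :: "real ^ ('a basis_index) \<Rightarrow> 'a" and L where
    Mb: "bounded_linear M" and Lb: "bounded_linear L" and
    M_L [simp]: "\<And>y. M (L y) = y" and L_M [simp]: "\<And>v. L (M v) = v"
    using euclidean_coordinates[OF fin] by blast
  have M: "linear M" "bij M" and L: "linear L"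
    using Mb Lb by (auto simp: bounded_linear.linear intro!: bij_betwI[of M UNIV UNIV L])
  let ?B = "M -` cball 0 1"
  have B_eq: "?B = L ` cball 0 1"
    by auto (metis L_M imageI mem_cball_0)
  have "compact ?B"
    unfolding B_eq using compact_cball_finite_dimensional[OF fin] Lb
    by (intro compact_continuous_image linear_continuous_on)
  moreover have "convex ?B"
    unfolding B_eq using L by (intro convex_linear_image) auto
  ultimately have hull: "?B = convex hull {v. v extreme_point_of ?B}"
    by (rule Krein_Milman_Minkowski)
  have "M ` {v. v extreme_point_of ?B} \<subseteq> {e. e extreme_point_of cball 0 1}"
    using extreme_point_of_linear_vimage[OF M] by auto
  then have "finite {v. v extreme_point_of ?B}"
    using poly M(2) unfolding polyhedral_norm_def
    by (meson bij_is_inj finite_imageD finite_subset inj_on_subset subset_UNIV)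
  then have "polytope ?B" using hull unfolding polytope_def by blast
  then have "polyhedron ?B" by (rule polytope_imp_polyhedron)
  then obtain H where H: "finite H" "?B = \<Inter>H"
      "\<forall>h\<in>H. \<exists>a b. a \<noteq> 0 \<and> h = {v. a \<bullet> v \<le> b}"
    unfolding polyhedron_def by blast
  have "\<exists>\<phi> :: 'a \<Rightarrow>\<^sub>L real. \<forall>y. L y \<in> h \<longleftrightarrow> blinfun_apply \<phi> y \<le> 1" if "h \<in> H" for h
  proof -
    from bspec[OF H(3) that] obtain a b where a: "a \<noteq> 0" and h: "h = {v. a \<bullet> v \<le> b}"
      by blast
    \<comment> \<open>A small positive multiple of the normal vector lies in the ball, which forces \<open>b > 0\<close>.\<close>
    define s where "s = 1 / (1 + norm (M a))"
    have den: "1 + norm (M a) > 0" by (simp add: add_pos_nonneg)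
    then have "s > 0" by (simp add: s_def)
    have "norm (M (s *\<^sub>R a)) = s * norm (M a)"
      using \<open>s > 0\<close> by (simp add: linear_scale[OF M(1)])
    also have "\<dots> \<le> 1" using den by (simp add: s_def)
    finally have "s *\<^sub>R a \<in> \<Inter>H" unfolding H(2)[symmetric] by simp
    then have "s *\<^sub>R a \<in> h" using that by (rule InterD)
    then have "s * (a \<bullet> a) \<le> b" by (simp add: h)
    moreover have "s * (a \<bullet> a) > 0" using a \<open>s > 0\<close> by simp
    ultimately have b: "b > 0" by linarith
    have "bounded_linear (\<lambda>y. (a /\<^sub>R b) \<bullet> L y)"
      by (rule bounded_linear_compose[OF bounded_linear_inner_right Lb])
    then have "blinfun_apply (Blinfun (\<lambda>y. (a /\<^sub>R b) \<bullet> L y)) = (\<lambda>y. (a /\<^sub>R b) \<bullet> L y)"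
      by (rule bounded_linear_Blinfun_apply)
    then have "L y \<in> h \<longleftrightarrow> blinfun_apply (Blinfun (\<lambda>y. (a /\<^sub>R b) \<bullet> L y)) y \<le> 1" for y
      using b by (simp add: h field_simps)
    then show ?thesis by blast
  qed
  then obtain \<phi> :: "_ \<Rightarrow> 'a \<Rightarrow>\<^sub>L real" where \<phi>: "\<And>h y. h \<in> H \<Longrightarrow> L y \<in> h \<longleftrightarrow> blinfun_apply (\<phi> h) y \<le> 1"
    by metis
  show ?thesis
  proof (rule that)
    show "finite (\<phi> ` H)" using H(1) by simp
    fix y :: 'a
    have "norm y \<le> 1 \<longleftrightarrow> L y \<in> ?B" by simp
    also have "\<dots> \<longleftrightarrow> (\<forall>h\<in>H. L y \<in> h)" unfolding H(2) by simp
    finally show "norm y \<le> 1 \<longleftrightarrow> (\<forall>\<psi>\<in>\<phi> ` H. blinfun_apply \<psi> y \<le> 1)" using \<phi> by auto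
  qed
qed

section \<open>Local geometry of a polyhedral unit ball\<close>

lemma mem_duality_map_unit:
  assumes "norm x = 1"
  shows "\<phi> \<in> duality_map x \<longleftrightarrow> norm \<phi> = 1 \<and> blinfun_apply \<phi> x = 1"
  using assms by (auto simp: duality_map_def)

lemma duality_map_le_norm:
  assumes "norm x = 1" "\<phi> \<in> duality_map x"
  shows "blinfun_apply \<phi> y \<le> norm y"
  using norm_blinfun[of \<phi> y] assms by (simp add: mem_duality_map_unit)

text \<open>
  Write the ball as a finite intersection of half-spaces \<open>\<phi> y \<le> 1\<close>. The functionals with
  \<open>\<phi> x = 1\<close> are norming functionals of \<open>x\<close>, so they do not increase in the direction \<open>w\<close>; the
  finitely many others have a positive slack at \<open>x\<close>, which a small \<open>w\<close> cannot exhaust.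
\<close>
lemma polyhedral_ball_locally_tangent_cone:
  fixes x :: "'a::real_normed_vector"
  assumes fin: "finite_dimensional_space TYPE('a)" and poly: "polyhedral_norm TYPE('a)"
    and x: "norm x = 1"
  obtains \<epsilon> where "\<epsilon> > 0"
    "\<And>w. norm w \<le> \<epsilon> \<Longrightarrow> (\<And>\<phi>. \<phi> \<in> duality_map x \<Longrightarrow> blinfun_apply \<phi> w \<le> 0) \<Longrightarrow> norm (x + w) \<le> 1"
proof -
  obtain \<Phi> :: "('a \<Rightarrow>\<^sub>L real) set" where "finite \<Phi>"
    and \<Phi>: "\<And>y::'a. norm y \<le> 1 \<longleftrightarrow> (\<forall>\<phi>\<in>\<Phi>. blinfun_apply \<phi> y \<le> 1)"
    using polyhedral_norm_finite_functionals[OF fin poly] by blast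
  have \<Phi>_le: "blinfun_apply \<phi> y \<le> norm y" if "\<phi> \<in> \<Phi>" for \<phi> y
  proof (cases "y = 0")
    case False
    have "norm (y /\<^sub>R norm y) \<le> 1" using False by simp
    then have "blinfun_apply \<phi> (y /\<^sub>R norm y) \<le> 1" using \<Phi> that by blast
    then show ?thesis using False by (simp add: blinfun.scaleR_right field_simps)
  qed (simp add: blinfun.zero_right)
  have \<Phi>_norm: "norm \<phi> \<le> 1" if "\<phi> \<in> \<Phi>" for \<phi>
  proof (rule norm_blinfun_bound)
    fix y show "norm (blinfun_apply \<phi> y) \<le> 1 * norm y"
      using \<Phi>_le[OF that, of y] \<Phi>_le[OF that, of "- y"] by (simp add: blinfun.minus_right abs_le_iff)
  qed simp
  have active: "\<phi> \<in> duality_map x" if "\<phi> \<in> \<Phi>" "\<not> blinfun_apply \<phi> x < 1" for \<phi>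
    using that \<Phi>_le[of \<phi> x] \<Phi>_norm[of \<phi>] norm_blinfun[of \<phi> x] x by (auto simp: mem_duality_map_unit)
  define \<epsilon> where "\<epsilon> = Min (insert 1 ((\<lambda>\<phi>. 1 - blinfun_apply \<phi> x) ` {\<phi> \<in> \<Phi>. blinfun_apply \<phi> x < 1}))"
  have fin_slacks: "finite (insert 1 ((\<lambda>\<phi>. 1 - blinfun_apply \<phi> x) ` {\<phi> \<in> \<Phi>. blinfun_apply \<phi> x < 1}))"
    using \<open>finite \<Phi>\<close> by simp
  show ?thesis
  proof (rule that)
    show "\<epsilon> > 0" unfolding \<epsilon>_def using fin_slacks by (subst Min_gr_iff) auto
    fix w assume w: "norm w \<le> \<epsilon>" "\<And>\<phi>. \<phi> \<in> duality_map x \<Longrightarrow> blinfun_apply \<phi> w \<le> 0"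
    have "blinfun_apply \<phi> (x + w) \<le> 1" if "\<phi> \<in> \<Phi>" for \<phi>
    proof (cases "blinfun_apply \<phi> x < 1")
      case True
      then have "\<epsilon> \<le> 1 - blinfun_apply \<phi> x"
        unfolding \<epsilon>_def using fin_slacks that by (intro Min_le) auto
      then show ?thesis using \<Phi>_le[OF that, of w] w(1) by (simp add: blinfun.add_right)
    next
      case False
      then show ?thesis
        using w(2)[OF active[OF that]] \<Phi>_le[OF that, of x] x by (simp add: blinfun.add_right)
    qed
    then show "norm (x + w) \<le> 1" using \<Phi> by blast
  qed
qed

text \<open>
  If \<open>x\<close> is a unit vector, this is the face of the ball dual to the face \<open>duality_map x\<close> of the dual
  ball. For a polyhedral norm it is the face that has \<open>x\<close> in its relative interior.
\<close>
definition bidual_face :: "'a::real_normed_vector \<Rightarrow> 'a set" where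
  "bidual_face x = {y \<in> cball 0 1. \<forall>\<phi>\<in>duality_map x. blinfun_apply \<phi> y = 1}"

lemma mem_bidual_face_self: "norm x = 1 \<Longrightarrow> x \<in> bidual_face x"
  by (simp add: bidual_face_def mem_duality_map_unit)

lemma bidual_face_of_cball:
  assumes x: "norm x = 1"
  shows "bidual_face x face_of cball 0 1"
  unfolding face_of_def
proof (intro conjI ballI impI)
  show "bidual_face x \<subseteq> cball 0 1" by (auto simp: bidual_face_def)
  have "convex {y. \<forall>\<phi>\<in>duality_map x. blinfun_apply \<phi> y = 1}"
    by (auto simp: convex_def blinfun.add_right blinfun.scaleR_right)
  moreover have "bidual_face x = cball 0 1 \<inter> {y. \<forall>\<phi>\<in>duality_map x. blinfun_apply \<phi> y = 1}"
    by (auto simp: bidual_face_def)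
  ultimately show "convex (bidual_face x)"
    by (simp add: convex_Int)
  fix a b z
  assume ab: "a \<in> cball 0 1" "b \<in> cball 0 1" and z: "z \<in> bidual_face x" "z \<in> open_segment a b"
  obtain s where s: "0 < s" "s < 1" and zs: "z = (1 - s) *\<^sub>R a + s *\<^sub>R b"
    using z(2) by (auto simp: in_segment)
  have "blinfun_apply \<phi> a = 1 \<and> blinfun_apply \<phi> b = 1" if \<phi>: "\<phi> \<in> duality_map x" for \<phi>
  proof -
    have le: "blinfun_apply \<phi> a \<le> 1" "blinfun_apply \<phi> b \<le> 1"
      using ab duality_map_le_norm[OF x \<phi>] by (force intro: order_trans)+
    have "blinfun_apply \<phi> ((1 - s) *\<^sub>R a + s *\<^sub>R b) = 1"
      using z(1) \<phi> by (simp add: bidual_face_def flip: zs)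
    then have eq: "(1 - s) * (1 - blinfun_apply \<phi> a) + s * (1 - blinfun_apply \<phi> b) = 0"
      by (simp only: blinfun.add_right blinfun.scaleR_right) (simp add: algebra_simps)
    have "(1 - s) * (1 - blinfun_apply \<phi> a) \<ge> 0" "s * (1 - blinfun_apply \<phi> b) \<ge> 0"
      using s le by simp_all
    then have "(1 - s) * (1 - blinfun_apply \<phi> a) = 0" "s * (1 - blinfun_apply \<phi> b) = 0"
      using eq by linarith+
    then show ?thesis using s by simp
  qed
  then show "a \<in> bidual_face x" "b \<in> bidual_face x"
    using ab by (auto simp: bidual_face_def)
qed

context
  fixes x :: "'a::real_normed_vector"
  assumes fin: "finite_dimensional_space TYPE('a)" and poly: "polyhedral_norm TYPE('a)"
    and x: "norm x = 1"
begin

text \<open>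
  Without norming functionals, every direction at \<open>x\<close> would be tangent, even the outward one.
\<close>
lemma duality_map_nonempty: "duality_map x \<noteq> {}"
proof
  assume "duality_map x = {}"
  moreover obtain \<epsilon> where "\<epsilon> > 0"
    "\<And>w. norm w \<le> \<epsilon> \<Longrightarrow> (\<And>\<phi>. \<phi> \<in> duality_map x \<Longrightarrow> blinfun_apply \<phi> w \<le> 0) \<Longrightarrow> norm (x + w) \<le> 1"
    using polyhedral_ball_locally_tangent_cone[OF fin poly x] by blast
  ultimately have "norm (x + \<epsilon> *\<^sub>R x) \<le> 1" using x by simp
  moreover have "x + \<epsilon> *\<^sub>R x = (1 + \<epsilon>) *\<^sub>R x" by (simp add: algebra_simps)
  ultimately show False using x \<open>\<epsilon> > 0\<close> by simp
qed

lemma bidual_face_proper: "bidual_face x \<in> nonempty_proper_faces (cball 0 1)"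
proof -
  have "0 \<notin> bidual_face x"
    using duality_map_nonempty by (auto simp: bidual_face_def blinfun.zero_right)
  moreover have "0 \<in> cball (0::'a) 1" by simp
  ultimately show ?thesis
    using bidual_face_of_cball[OF x] mem_bidual_face_self[OF x]
    unfolding nonempty_proper_faces_def by blast
qed

text \<open>
  On the affine hull of the bidual face, all norming functionals of \<open>x\<close> are 1, so the displacements
  from \<open>x\<close> within this hull lie in the tangent cone, and short ones stay in the ball.
\<close>
lemma mem_rel_interior_bidual_face: "x \<in> rel_interior (bidual_face x)"
proof -
  obtain \<epsilon> where "\<epsilon> > 0" and \<epsilon>:
    "\<And>w. norm w \<le> \<epsilon> \<Longrightarrow> (\<And>\<phi>. \<phi> \<in> duality_map x \<Longrightarrow> blinfun_apply \<phi> w \<le> 0) \<Longrightarrow> norm (x + w) \<le> 1"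
    using polyhedral_ball_locally_tangent_cone[OF fin poly x] by blast
  define A where "A = {y. \<forall>\<phi>\<in>duality_map x. blinfun_apply \<phi> y = 1}"
  have "affine A"
    by (auto simp: A_def affine_def blinfun.add_right blinfun.scaleR_right)
  then have hull: "affine hull (bidual_face x) \<subseteq> A"
    by (intro hull_minimal) (auto simp: A_def bidual_face_def)
  have "z \<in> bidual_face x" if "z \<in> cball x \<epsilon>" "z \<in> A" for z
  proof -
    have "norm (x + (z - x)) \<le> 1"
      using that x by (intro \<epsilon>) (auto simp: dist_norm norm_minus_commute A_def blinfun.diff_right mem_duality_map_unit)
    then show ?thesis using that(2) by (simp add: bidual_face_def A_def)
  qed
  then have "cball x \<epsilon> \<inter> affine hull (bidual_face x) \<subseteq> bidual_face x"
    using hull by blast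
  then show ?thesis
    using \<open>\<epsilon> > 0\<close> mem_bidual_face_self[OF x] unfolding mem_rel_interior_cball by blast
qed

text \<open>
  The norming functionals of \<open>x\<close> take the value \<open>1 - \<eta>\<close> at \<open>x - \<eta> *\<^sub>R y\<close>, which makes \<open>1 - \<eta>\<close> the
  least possible norm; for small \<open>\<eta>\<close> it is the norm, as the rescaled vector differs from \<open>x\<close> by a
  short vector that all these functionals annihilate.
\<close>
lemma norm_diff_bidual_face:
  obtains \<eta> where "\<eta> > 0" "\<And>y. y \<in> bidual_face x \<Longrightarrow> norm (x - \<eta> *\<^sub>R y) \<le> 1 - \<eta>"
proof -
  obtain \<epsilon> where "\<epsilon> > 0" and \<epsilon>:
    "\<And>w. norm w \<le> \<epsilon> \<Longrightarrow> (\<And>\<phi>. \<phi> \<in> duality_map x \<Longrightarrow> blinfun_apply \<phi> w \<le> 0) \<Longrightarrow> norm (x + w) \<le> 1"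
    using polyhedral_ball_locally_tangent_cone[OF fin poly x] by blast
  \<comment> \<open>The vector \<open>w\<close> below has norm at most \<open>2 * \<eta> / (1 - \<eta>)\<close>, which is at most \<open>4 * \<eta>\<close> if \<open>\<eta> \<le> 1/2\<close>.\<close>
  define \<eta> where "\<eta> = min (1/2) (\<epsilon>/4)"
  have \<eta>: "\<eta> > 0" "\<eta> \<le> 1/2" "4 * \<eta> \<le> \<epsilon>" using \<open>\<epsilon> > 0\<close> by (auto simp: \<eta>_def)
  show ?thesis
  proof (rule that[OF \<eta>(1)])
    fix y assume y: "y \<in> bidual_face x"
    \<comment> \<open>The choice of \<open>w\<close> makes \<open>x + w\<close> equal to \<open>x - \<eta> *\<^sub>R y\<close> divided by \<open>1 - \<eta>\<close>.\<close>
    define w where "w = (\<eta> / (1 - \<eta>)) *\<^sub>R (x - y)"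
    have "norm (x - y) \<le> 2"
      using norm_triangle_ineq4[of x y] x y by (simp add: bidual_face_def)
    then have w: "norm w \<le> \<eta> / (1 - \<eta>) * 2"
      unfolding w_def using \<eta> by (simp add: divide_right_mono)
    have "\<epsilon> * \<eta> \<le> \<epsilon> * (1/2)"
      using \<eta> \<open>\<epsilon> > 0\<close> by (intro mult_left_mono) auto
    then have "2 * \<eta> \<le> \<epsilon> * (1 - \<eta>)"
      unfolding right_diff_distrib using \<eta>(3) by linarith
    then have "\<eta> / (1 - \<eta>) * 2 \<le> \<epsilon>"
      using \<eta>(2) by (simp add: pos_divide_le_eq mult.commute)
    then have "norm w \<le> \<epsilon>" using w by (rule order_trans[rotated])
    then have "norm (x + w) \<le> 1"
      using x y by (intro \<epsilon>)
        (auto simp: w_def blinfun.scaleR_right blinfun.diff_right mem_duality_map_unit bidual_face_def)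
    moreover have "(1 - \<eta>) *\<^sub>R w = \<eta> *\<^sub>R (x - y)"
      using \<eta>(2) by (simp add: w_def)
    then have "x - \<eta> *\<^sub>R y = (1 - \<eta>) *\<^sub>R (x + w)"
      unfolding scaleR_right_distrib by (simp add: algebra_simps)
    ultimately show "norm (x - \<eta> *\<^sub>R y) \<le> 1 - \<eta>"
      using \<eta>(2) by (simp add: mult_left_le)
  qed
qed

end

section \<open>Dual faces\<close>

lemma norm_nonempty_proper_face:
  assumes "F \<in> nonempty_proper_faces (cball 0 1)" "p \<in> F"
  shows "norm p = 1"
proof -
  have F: "F face_of cball 0 1" "F \<noteq> cball 0 1"
    using assms(1) by (auto simp: nonempty_proper_faces_def)
  have "ball 0 1 \<subseteq> interior (cball (0::'a) 1)"
    by (intro interior_maximal) auto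
  then have "p \<notin> ball 0 1" using face_of_disjoint_interior[OF F] assms(2) by blast
  moreover have "p \<in> cball 0 1" using face_of_imp_subset[OF F(1)] assms(2) by blast
  ultimately show ?thesis by simp
qed

text \<open>
  A functional that is norming at one relative interior point of \<open>F\<close> attains its maximum over
  \<open>F\<close> there, so it is constant on \<open>F\<close> and norming at every point of \<open>F\<close>.
\<close>
lemma dual_face_eq_duality_map:
  assumes F: "F \<in> nonempty_proper_faces (cball 0 1)" and p: "p \<in> rel_interior F"
  shows "dual_face F = duality_map p"
proof -
  have n1: "norm q = 1" if "q \<in> F" for q
    using norm_nonempty_proper_face[OF F that] .
  have sub: "duality_map a \<subseteq> duality_map b" if a: "a \<in> rel_interior F" and b: "b \<in> rel_interior F" for a b
  proof
    fix \<phi> assume \<phi>: "\<phi> \<in> duality_map a"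
    have ab: "a \<in> F" "b \<in> F" using a b rel_interior_subset by auto
    have "linear (blinfun_apply \<phi>)" by (simp add: bounded_linear.linear blinfun.bounded_linear_right)
    moreover have "blinfun_apply \<phi> y \<le> blinfun_apply \<phi> a" if "y \<in> F" for y
      using duality_map_le_norm[OF n1[OF ab(1)] \<phi>, of y] \<phi> n1[OF that] n1[OF ab(1)]
      by (simp add: mem_duality_map_unit)
    ultimately have "blinfun_apply \<phi> b = blinfun_apply \<phi> a"
      using a ab(2) by (rule linear_maximum_on_rel_interior_constant)
    then show "\<phi> \<in> duality_map b" using \<phi> n1 ab by (simp add: mem_duality_map_unit)
  qed
  show ?thesis unfolding dual_face_def using sub p by blast
qed

text \<open>
  Evaluation at \<open>w\<close> is at most 1 on \<open>duality_map x\<close> and attains this bound at the relative interior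
  point \<open>\<psi>\<close>, so it is identically 1.
\<close>
lemma mem_bidual_face_if_rel_interior:
  assumes x: "norm x = 1" and \<psi>: "\<psi> \<in> rel_interior (duality_map x)"
    and w: "norm w \<le> 1" "blinfun_apply \<psi> w \<ge> 1"
  shows "w \<in> bidual_face x"
proof -
  have le: "blinfun_apply \<phi> w \<le> 1" if "\<phi> \<in> duality_map x" for \<phi>
    using duality_map_le_norm[OF x that, of w] w(1) by simp
  then have one: "blinfun_apply \<psi> w = 1" using w(2) \<psi> rel_interior_subset by (meson antisym subsetD)
  have "linear (\<lambda>\<phi>. blinfun_apply \<phi> w)"
    by (rule linearI) (simp_all add: blinfun.add_left blinfun.scaleR_left)
  then have "blinfun_apply \<phi> w = blinfun_apply \<psi> w" if "\<phi> \<in> duality_map x" for \<phi>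
    using le one \<psi> that by (intro linear_maximum_on_rel_interior_constant) auto
  then show ?thesis using w(1) one by (simp add: bidual_face_def)
qed

section \<open>Fixed points and faces\<close>

text \<open>
  Going from \<open>t *\<^sub>R x\<close> to \<open>s *\<^sub>R p\<close> with \<open>s = \<eta> * t\<close> costs only the distance \<open>t - s\<close>, which is exactly the
  drop of \<open>\<phi>\<close>. As \<open>g\<close> fixes the first point and does not increase distances, \<open>\<phi>\<close> cannot drop
  below \<open>s\<close> at the image of the second one.
\<close>
lemma fixed_point_imp_functional_nondecreasing:
  fixes g :: "'a::real_normed_vector \<Rightarrow> 'a"
  assumes fin: "finite_dimensional_space TYPE('a)" and poly: "polyhedral_norm TYPE('a)"
    and g: "nonexpansive g" and x: "norm x = 1" and t: "t > 0" and fixed: "g (t *\<^sub>R x) = t *\<^sub>R x"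
    and p: "p \<in> bidual_face x" and \<phi>: "\<phi> \<in> duality_map x"
  shows "\<exists>s>0. blinfun_apply \<phi> (g (s *\<^sub>R p) - s *\<^sub>R p) \<ge> 0"
proof -
  obtain \<eta> where "\<eta> > 0" and \<eta>: "norm (x - \<eta> *\<^sub>R p) \<le> 1 - \<eta>"
    using norm_diff_bidual_face[OF fin poly x] p by blast
  define s where "s = \<eta> * t"
  have "blinfun_apply \<phi> (t *\<^sub>R x - g (s *\<^sub>R p)) \<le> norm (g (t *\<^sub>R x) - g (s *\<^sub>R p))"
    using duality_map_le_norm[OF x \<phi>] fixed by simp
  also have "\<dots> \<le> norm (t *\<^sub>R x - s *\<^sub>R p)"
    using g by (simp add: nonexpansive_def)
  also have "t *\<^sub>R x - s *\<^sub>R p = t *\<^sub>R (x - \<eta> *\<^sub>R p)"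
    by (simp add: s_def algebra_simps)
  also have "norm \<dots> \<le> t * (1 - \<eta>)" using \<eta> t by simp
  finally have "blinfun_apply \<phi> (g (s *\<^sub>R p)) \<ge> s"
    using x \<phi> by (simp add: blinfun.diff_right blinfun.scaleR_right mem_duality_map_unit s_def algebra_simps)
  moreover have "blinfun_apply \<phi> p = 1" using p \<phi> by (simp add: bidual_face_def)
  moreover have "s > 0" using \<open>\<eta> > 0\<close> t by (simp add: s_def)
  ultimately show ?thesis by (intro exI[of _ s]) (simp add: blinfun.diff_right blinfun.scaleR_right)
qed

text \<open>
  Scale the bidual face of \<open>p\<close> by \<open>R = \<eta> * t\<close>. A point of the scaled face has norm at most \<open>R\<close>, and so
  has its image because \<open>g 0 = 0\<close>; conversely the norming functionals of \<open>p\<close> are at least \<open>R\<close> at the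
  image, because it lies within \<open>t - R\<close> of \<open>t *\<^sub>R w\<close>, where they equal \<open>t\<close>. Thus \<open>g\<close> maps the scaled
  face into itself.
\<close>
lemma nonzero_fixed_point_if_bidual_face_preserved:
  fixes g :: "'a::real_normed_vector \<Rightarrow> 'a"
  assumes fin: "finite_dimensional_space TYPE('a)" and poly: "polyhedral_norm TYPE('a)"
    and g: "nonexpansive g" and g0: "g 0 = 0" and p: "norm p = 1" and t: "t > 0"
    and w: "g (t *\<^sub>R p) = t *\<^sub>R w" "w \<in> bidual_face p"
  shows "\<exists>y. y \<noteq> 0 \<and> g y = y"
proof -
  obtain \<eta> where "\<eta> > 0" and \<eta>: "\<And>b. b \<in> bidual_face p \<Longrightarrow> norm (p - \<eta> *\<^sub>R b) \<le> 1 - \<eta>"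
    using norm_diff_bidual_face[OF fin poly p] by blast
  define R where "R = \<eta> * t"
  have "R > 0" using \<open>\<eta> > 0\<close> t by (simp add: R_def)
  let ?C = "(*\<^sub>R) R ` bidual_face p"
  have "bidual_face p = cball 0 1 \<inter> (\<Inter>\<phi>\<in>duality_map p. {y. blinfun_apply \<phi> y = 1})"
    by (auto simp: bidual_face_def)
  moreover have "closed {y. blinfun_apply \<phi> y = 1}" for \<phi> :: "'a \<Rightarrow>\<^sub>L real"
    by (intro closed_Collect_eq continuous_intros)
  ultimately have "compact (bidual_face p)"
    using compact_cball_finite_dimensional[OF fin] by (simp add: compact_Int_closed closed_INT)
  then have "compact ?C" by (rule compact_scaling)
  moreover have "convex ?C"
    using bidual_face_of_cball[OF p] by (intro convex_scaling face_of_imp_convex)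
  moreover have "?C \<noteq> {}" using mem_bidual_face_self[OF p] by blast
  moreover have "g ` ?C \<subseteq> ?C"
  proof safe
    fix b assume b: "b \<in> bidual_face p"
    let ?y = "R *\<^sub>R b"
    have "norm (g ?y) \<le> norm ?y"
      using g g0 unfolding nonexpansive_def by (metis diff_zero)
    also have "\<dots> \<le> R" using b \<open>R > 0\<close> by (simp add: bidual_face_def)
    finally have gy: "norm (g ?y) \<le> R" .
    have "blinfun_apply \<phi> (g ?y) = R" if \<phi>: "\<phi> \<in> duality_map p" for \<phi>
    proof -
      have "blinfun_apply \<phi> (t *\<^sub>R w - g ?y) \<le> norm (g (t *\<^sub>R p) - g ?y)"
        using duality_map_le_norm[OF p \<phi>] w(1) by simp
      also have "\<dots> \<le> norm (t *\<^sub>R p - ?y)"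
        using g by (simp add: nonexpansive_def)
      also have "t *\<^sub>R p - ?y = t *\<^sub>R (p - \<eta> *\<^sub>R b)"
        by (simp add: R_def algebra_simps)
      also have "norm \<dots> \<le> t * (1 - \<eta>)" using \<eta>[OF b] t by simp
      finally have "blinfun_apply \<phi> (g ?y) \<ge> R"
        using w(2) \<phi> by (simp add: bidual_face_def blinfun.diff_right blinfun.scaleR_right R_def algebra_simps)
      then show ?thesis using duality_map_le_norm[OF p \<phi>, of "g ?y"] gy by simp
    qed
    then have "g ?y /\<^sub>R R \<in> bidual_face p"
      using gy \<open>R > 0\<close> by (simp add: bidual_face_def blinfun.scaleR_right field_simps)
    then show "g ?y \<in> ?C" using \<open>R > 0\<close> by (intro image_eqI[of _ _ "g ?y /\<^sub>R R"]) simp_all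
  qed
  ultimately obtain y where "y \<in> ?C" "g y = y"
    using nonexpansive_on_compact_convex_fixed_point[OF _ _ _ _ g] by blast
  moreover have "0 \<notin> ?C"
    using duality_map_nonempty[OF fin poly p] \<open>R > 0\<close> by (auto simp: bidual_face_def blinfun.zero_right)
  ultimately show ?thesis by metis
qed

theorem corollary6p3:
  fixes f :: "'a::banach \<Rightarrow> 'a"
    and u :: 'a
    and x :: "'a set \<Rightarrow> 'a"
    and x' :: "'a set \<Rightarrow> ('a \<Rightarrow>\<^sub>L real)"
  assumes "finite_dimensional_space TYPE('a)"
    and "polyhedral_norm TYPE('a)"
    and "nonexpansive f"
    and "f u = u"
    and "\<And>F. F \<in> nonempty_proper_faces (cball 0 1) \<Longrightarrow> x F \<in> rel_interior F"
    and "\<And>F. F \<in> nonempty_proper_faces (cball 0 1) \<Longrightarrow> x' F \<in> rel_interior (dual_face F)"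
  shows "{v. f v = v} = {u} \<longleftrightarrow>
    (\<forall>t>0. \<forall>F\<in>nonempty_proper_faces (cball 0 1).
       blinfun_apply (x' F) (f (u + t *\<^sub>R x F) - u - t *\<^sub>R x F) < 0)"
proof -
  note fin = assms(1) and poly = assms(2)
  define g where "g y = f (u + y) - u" for y
  have g: "nonexpansive g"
    unfolding nonexpansive_def
  proof (intro allI)
    fix a b
    show "norm (g a - g b) \<le> norm (a - b)"
      using assms(3)[unfolded nonexpansive_def, rule_format, of "u + a" "u + b"] by (simp add: g_def)
  qed
  have g0: "g 0 = 0" using assms(4) by (simp add: g_def)
  have unique: "{v. f v = v} = {u} \<longleftrightarrow> (\<forall>y. g y = y \<longrightarrow> y = 0)"
  proof
    assume *: "{v. f v = v} = {u}"
    show "\<forall>y. g y = y \<longrightarrow> y = 0"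
    proof (intro allI impI)
      fix y assume "g y = y"
      then have "f (u + y) = u + y" by (simp add: g_def algebra_simps)
      then have "u + y \<in> {u}" using * by blast
      then show "y = 0" by simp
    qed
  next
    assume *: "\<forall>y. g y = y \<longrightarrow> y = 0"
    have "v = u" if "f v = v" for v
      using *[rule_format, of "v - u"] that by (simp add: g_def)
    then show "{v. f v = v} = {u}" using assms(4) by blast
  qed
  show ?thesis unfolding unique
  proof
    assume uniq: "\<forall>y. g y = y \<longrightarrow> y = 0"
    show "\<forall>t>0. \<forall>F\<in>nonempty_proper_faces (cball 0 1).
       blinfun_apply (x' F) (f (u + t *\<^sub>R x F) - u - t *\<^sub>R x F) < 0"
    proof (intro allI impI ballI, rule ccontr)
      fix t :: real and F :: "'a set"
      assume t: "t > 0" and F: "F \<in> nonempty_proper_faces (cball 0 1)"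
        and neg: "\<not> blinfun_apply (x' F) (f (u + t *\<^sub>R x F) - u - t *\<^sub>R x F) < 0"
      have xF: "norm (x F) = 1"
        using norm_nonempty_proper_face[OF F] assms(5)[OF F] rel_interior_subset by blast
      have x'F: "x' F \<in> rel_interior (duality_map (x F))"
        using assms(6)[OF F] dual_face_eq_duality_map[OF F assms(5)[OF F]] by simp
      then have x'_xF: "blinfun_apply (x' F) (x F) = 1"
        using subsetD[OF rel_interior_subset x'F] xF by (simp add: mem_duality_map_unit)
      define w where "w = g (t *\<^sub>R x F) /\<^sub>R t"
      have "norm (g (t *\<^sub>R x F)) \<le> norm (t *\<^sub>R x F)"
        using g g0 unfolding nonexpansive_def by (metis diff_zero)
      then have "norm w \<le> 1" using t xF by (simp add: w_def field_simps)
      moreover have le: "blinfun_apply (x' F) (g (t *\<^sub>R x F) - t *\<^sub>R x F) \<ge> 0"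
        using neg by (simp only: g_def not_less)
      have "blinfun_apply (x' F) w \<ge> 1"
        using le t x'_xF by (simp add: w_def blinfun.diff_right blinfun.scaleR_right field_simps)
      ultimately have "w \<in> bidual_face (x F)"
        by (rule mem_bidual_face_if_rel_interior[OF xF x'F])
      moreover have "g (t *\<^sub>R x F) = t *\<^sub>R w" using t by (simp add: w_def)
      ultimately have "\<exists>y. y \<noteq> 0 \<and> g y = y"
        using nonzero_fixed_point_if_bidual_face_preserved[OF fin poly g g0 xF t] by blast
      then show False using uniq by blast
    qed
  next
    assume neg: "\<forall>t>0. \<forall>F\<in>nonempty_proper_faces (cball 0 1).
       blinfun_apply (x' F) (f (u + t *\<^sub>R x F) - u - t *\<^sub>R x F) < 0"
    show "\<forall>y. g y = y \<longrightarrow> y = 0"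
    proof (intro allI impI, rule ccontr)
      fix y assume y: "g y = y" "y \<noteq> 0"
      define t where "t = norm y"
      define z where "z = y /\<^sub>R t"
      have t: "t > 0" and z: "norm z = 1" and yz: "y = t *\<^sub>R z"
        using y(2) by (auto simp: t_def z_def)
      let ?F = "bidual_face z"
      have F: "?F \<in> nonempty_proper_faces (cball 0 1)"
        by (rule bidual_face_proper[OF fin poly z])
      have "dual_face ?F = duality_map z"
        using dual_face_eq_duality_map[OF F mem_rel_interior_bidual_face[OF fin poly z]] .
      then have "x' ?F \<in> duality_map z" "x ?F \<in> ?F"
        using assms(5,6)[OF F] rel_interior_subset by blast+
      then obtain s where "s > 0" "blinfun_apply (x' ?F) (g (s *\<^sub>R x ?F) - s *\<^sub>R x ?F) \<ge> 0"
        using fixed_point_imp_functional_nondecreasing[OF fin poly g z t] y(1) yz by metis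
      then show False using neg F by (fastforce simp: g_def)
    qed
  qed
qed

end
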